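(* Let $X_1,X_2,\dots$ be independent random vectors with common distribution $P$ on $\mathbb{R}^p$, with $X_i=(X_{i1},\dots,X_{ip})^T$, and let $R_1,R_2,\dots$ be i.i.d. random vectors in $\{0,1\}^p$, with $R_i=(R_{i1},\dots,R_{ip})^T$, such that the sequence $(R_i)_i$ is independent of the sequence $(X_i)_i$ and $\Pr(R_1=(1,\dots,1)^T)>0$. Let $k\ge1$ be an integer. For $\mathrm{M}=(\mu_{lj})\in\mathbb{R}^{k\times p}$ define $$\widehat{L}_n^{(\mathrm{KPOD})}(\mathrm{M})=\frac1n\sum_{i=1}^n\min_{1\le l\le k}\sum_{j=1}^pR_{ij}(X_{ij}-\mu_{lj})^2,\qquad L^{(\mathrm{KPOD})}(\mathrm{M})=E\Big[\min_{1\le l\le k}\sum_{j=1}^pR_{1j}(X_{1j}-\mu_{lj})^2\Big].$$ For each $n$ let $\widehat{\mathrm{M}}_{\mathrm{KPOD}}\in\arg\min_{\mathrm{M}}\widehat{L}_n^{(\mathrm{KPOD})}(\mathrm{M})$, and let $\mathcal{M}^\ast_{\mathrm{KPOD}}=\arg\min_{\mathrm{M}}L^{(\mathrm{KPOD})}(\mathrm{M})$, where $\mathrm{M}$ ranges over $\mathbb{R}^{k\times p}$. Assume that $\|X_1\|$ is bounded almost surely, i.e. there is a constant $C>0$ with $\|X_1\|<C$ almost surely. Then, as $n\to\infty$, $$L^{(\mathrm{KPOD})}\big(\widehat{\mathrm{M}}_{\mathrm{KPOD}}\big)\to\min_{\mathrm{M}}L^{(\mathrm{KPOD})}(\mathrm{M})\quad\text{and}\quad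 d\big(\widehat{\mathrm{M}}_{\mathrm{KPOD}},\mathcal{M}^\ast_{\mathrm{KPOD}}\big)\to0\quad\text{almost surely},$$ where $d(\mathrm{M},\mathcal{M}^\ast_{\mathrm{KPOD}})=\min_{\mathrm{M}^\ast\in\mathcal{M}^\ast_{\mathrm{KPOD}}}\|\mathrm{M}-\mathrm{M}^\ast\|$.
   Context: $R_{ij}=1$ means that the entry $X_{ij}$ is observed and $R_{ij}=0$ that it is missing (missing completely at random). The law of $R_1$ on $\{0,1\}^p$ is arbitrary apart from the stated positivity condition. The rows $\mu_1,\dots,\mu_k\in\mathbb{R}^p$ of $\mathrm{M}$ are the cluster centers. $\widehat{L}_n^{(\mathrm{KPOD})}$ and $L^{(\mathrm{KPOD})}$ are the empirical and expected losses of the $k$-POD clustering. The estimator $\widehat{\mathrm{M}}_{\mathrm{KPOD}}$ depends on $n$ and on the data, and is any minimizer of the empirical loss. Neither the empirical nor the expected loss is assumed to have a unique minimizer. $\|\cdot\|$ is the Euclidean norm on vectors and the Frobenius norm on matrices. *)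

theory Defs
  imports "HOL-Probability.Probability"
begin

text \<open>
  The matrix of cluster centers is an element of \<open>real ^ 'p ^ 'k\<close> with rows \<open>\<mu> $ l\<close>;
  its \<open>norm\<close> is the Frobenius norm. Observation indicators are real vectors with entries
  in \<open>{0, 1}\<close>. Sequences are indexed from \<open>0\<close>, so \<open>X 0\<close> and \<open>R 0\<close> play the role of
  \<open>X\<^sub>1\<close> and \<open>R\<^sub>1\<close>.
\<close>

definition kpod_cost :: "real ^ 'p \<Rightarrow> real ^ 'p \<Rightarrow> real ^ 'p ^ 'k \<Rightarrow> real" where
  "kpod_cost r x \<mu> = (MIN l. \<Sum>j\<in>UNIV. r $ j * (x $ j - \<mu> $ l $ j)\<^sup>2)"

definition kpod_empirical_loss ::
  "(nat \<Rightarrow> 'w \<Rightarrow> real ^ 'p) \<Rightarrow> (nat \<Rightarrow> 'w \<Rightarrow> real ^ 'p) \<Rightarrow> nat \<Rightarrow> 'w \<Rightarrow> real ^ 'p ^ 'k \<Rightarrow> real" where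
  "kpod_empirical_loss R X n \<omega> \<mu> = 1 / real n * (\<Sum>i<n. kpod_cost (R i \<omega>) (X i \<omega>) \<mu>)"

definition kpod_loss ::
  "'w measure \<Rightarrow> ('w \<Rightarrow> real ^ 'p) \<Rightarrow> ('w \<Rightarrow> real ^ 'p) \<Rightarrow> real ^ 'p ^ 'k \<Rightarrow> real" where
  "kpod_loss N r x \<mu> = (\<integral>\<omega>. kpod_cost (r \<omega>) (x \<omega>) \<mu> \<partial>N)"

definition argmin_set :: "('a \<Rightarrow> real) \<Rightarrow> 'a set" where
  "argmin_set f = {x. is_arg_min f (\<lambda>_. True) x}"

end

theory Submission imports Defs begin

text \<open>
  The empirical loss converges almost surely to the expected loss at every matrix of centers.
  To pass from this to minimizers one would like the matrices \<open>Mhat n \<omega>\<close> to stay in a compact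
  set. They need not: a row may have entries that tend to infinity as long as the row serves
  only patterns in which these entries are not observed, and the set of minimizers of
  the expected loss may itself be unbounded.

  The way out is to compactify. Along a subsequence every entry of \<open>Mhat n \<omega>\<close> either converges
  or diverges to infinity. Fill a matrix \<open>\<kappa>\<close> with the limits in the convergent places and with
  arbitrary numbers in the divergent ones. For bounded data and large \<open>n\<close>, the cost of \<open>\<kappa>\<close> is at
  most slightly larger than the cost of \<open>Mhat n \<omega>\<close>, uniformly in the data point and in the
  observation pattern: rows that observe a divergent entry have become too expensive to matter,
  and in the other rows the observed entries of the two matrices are close
  (\<open>almost_dominates_of_entries\<close>). So for each matrix \<open>\<nu>\<close> the empirical loss of \<open>\<kappa>\<close> is, up to
  small errors, at most that of \<open>Mhat n \<omega>\<close>, hence at most that of \<open>\<nu>\<close>. In the limit \<open>\<kappa>\<close> is a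
  minimizer of the expected loss, for every filling. Filling the divergent places with the
  entries of \<open>Mhat n \<omega>\<close> itself gives minimizers \<open>\<kappa> n\<close> whose distance to \<open>Mhat n \<omega>\<close> tends to
  zero along the subsequence (\<open>subseq_close_to_minimizers\<close>). This proves the second limit, and the first follows by a
  continuity estimate that is uniform over all minimizers. The same argument for a minimizing
  sequence of the expected loss shows that minimizers exist.

  On the probabilistic side, a strong law for bounded variables and independence of the
  pairs \<open>(R i, X i)\<close> give convergence of the empirical loss at the points of a countable dense
  set of matrices. It extends to all matrices because costs of nearby matrices are comparable
  with constants that do not depend on the data (\<open>tendsto_of_tendsto_on_dense\<close>).
\<close>

section \<open>Comparing costs of two center matrices\<close>

text \<open>
  The right-hand side minus the left-hand side is a square divided by \<open>\<delta>\<close>. A multiplicative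
  error is what makes the comparisons below uniform in the data point \<open>a\<close>: an additive bound
  on \<open>(a - u)\<^sup>2 - (a - v)\<^sup>2\<close> would depend on how large \<open>a\<close>, \<open>u\<close> and \<open>v\<close> are.
\<close>

lemma young_square_diff:
  fixes a u v \<delta> :: real
  assumes "\<delta> > 0"
  shows "(a - u)\<^sup>2 \<le> (1 + \<delta>) * (a - v)\<^sup>2 + (1 + 1 / \<delta>) * (u - v)\<^sup>2"
proof -
  have "(1 + \<delta>) * (a - v)\<^sup>2 + (1 + 1 / \<delta>) * (u - v)\<^sup>2 - (a - u)\<^sup>2
      = (\<delta> * (a - v) + (u - v))\<^sup>2 / \<delta>"
    using assms by (simp add: field_simps power2_eq_square)
  also have "\<dots> \<ge> 0"
    using assms by simp
  finally show ?thesis by simp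
qed

definition obs_mask :: "real ^ 'p \<Rightarrow> bool" where
  "obs_mask r \<longleftrightarrow> (\<forall>j. r $ j \<in> {0, 1})"

lemma obs_mask_cases: "obs_mask r \<Longrightarrow> r $ j = 0 \<or> r $ j = 1"
  by (simp add: obs_mask_def)

definition row_cost :: "real ^ 'p \<Rightarrow> real ^ 'p \<Rightarrow> real ^ 'p \<Rightarrow> real" where
  "row_cost r x u = (\<Sum>j\<in>UNIV. r $ j * (x $ j - u $ j)\<^sup>2)"

lemma obs_mask_nonneg: "obs_mask r \<Longrightarrow> 0 \<le> r $ j"
  using obs_mask_cases[of r j] by auto

lemma obs_mask_le_1: "obs_mask r \<Longrightarrow> r $ j \<le> 1"
  using obs_mask_cases[of r j] by auto

lemma row_cost_nonneg: "obs_mask r \<Longrightarrow> row_cost r x u \<ge> 0"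
  unfolding row_cost_def by (intro sum_nonneg mult_nonneg_nonneg obs_mask_nonneg) auto

lemma kpod_cost_le_row: "kpod_cost r x \<mu> \<le> row_cost r x (\<mu> $ l)"
  unfolding kpod_cost_def row_cost_def by (intro Min_le) auto

lemma kpod_cost_attained: "\<exists>l. kpod_cost r x \<mu> = row_cost r x (\<mu> $ l)"
proof -
  have "kpod_cost r x \<mu> \<in> range (\<lambda>l. row_cost r x (\<mu> $ l))"
    unfolding kpod_cost_def row_cost_def by (intro Min_in) auto
  then show ?thesis by auto
qed

lemma kpod_cost_nonneg: "obs_mask r \<Longrightarrow> kpod_cost r x \<mu> \<ge> 0"
  using kpod_cost_attained[of r x \<mu>] row_cost_nonneg[of r x] by force

lemma row_cost_le_norm: "obs_mask r \<Longrightarrow> row_cost r x u \<le> (norm (x - u))\<^sup>2"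
proof -
  assume r: "obs_mask r"
  have "row_cost r x u \<le> (\<Sum>j\<in>UNIV. (x $ j - u $ j)\<^sup>2)"
    unfolding row_cost_def
    by (intro sum_mono mult_left_le_one_le) (auto intro: r obs_mask_nonneg obs_mask_le_1)
  also have "\<dots> = (norm (x - u))\<^sup>2"
    by (simp add: norm_vec_def L2_set_def sum_nonneg)
  finally show ?thesis .
qed

lemma kpod_cost_le:
  assumes "obs_mask r" "norm x \<le> C"
  shows "kpod_cost r x \<mu> \<le> (C + norm \<mu>)\<^sup>2"
proof -
  obtain l where l: "kpod_cost r x \<mu> = row_cost r x (\<mu> $ l)"
    using kpod_cost_attained by blast
  have "norm (x - \<mu> $ l) \<le> C + norm \<mu>"
    using norm_triangle_ineq4[of x "\<mu> $ l"] Finite_Cartesian_Product.norm_nth_le[of \<mu> l] assms(2) by linarith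
  then have "(norm (x - \<mu> $ l))\<^sup>2 \<le> (C + norm \<mu>)\<^sup>2"
    by (intro power_mono) auto
  then show ?thesis
    using l row_cost_le_norm[OF assms(1), of x "\<mu> $ l"] by linarith
qed

lemma row_cost_perturb:
  assumes r: "obs_mask r" and \<delta>: "\<delta> > 0"
    and close: "(\<Sum>j\<in>UNIV. r $ j * (u $ j - v $ j)\<^sup>2) \<le> \<delta>\<^sup>2"
  shows "row_cost r x u \<le> (1 + \<delta>) * row_cost r x v + (\<delta> + \<delta>\<^sup>2)"
proof -
  have "row_cost r x u
      \<le> (\<Sum>j\<in>UNIV. r $ j * ((1 + \<delta>) * (x $ j - v $ j)\<^sup>2 + (1 + 1 / \<delta>) * (u $ j - v $ j)\<^sup>2))"
    unfolding row_cost_def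
    by (intro sum_mono mult_left_mono young_square_diff \<delta> obs_mask_nonneg r)
  also have "\<dots> = (1 + \<delta>) * row_cost r x v + (1 + 1 / \<delta>) * (\<Sum>j\<in>UNIV. r $ j * (u $ j - v $ j)\<^sup>2)"
    unfolding row_cost_def by (simp add: sum_distrib_left sum.distrib ring_distribs mult_ac)
  also have "\<dots> \<le> (1 + \<delta>) * row_cost r x v + (1 + 1 / \<delta>) * \<delta>\<^sup>2"
    using \<delta> close by (intro add_left_mono mult_left_mono) auto
  also have "(1 + 1 / \<delta>) * \<delta>\<^sup>2 = \<delta> + \<delta>\<^sup>2"
    using \<delta> by (simp add: field_simps power2_eq_square)
  finally show ?thesis .
qed

text \<open>
  The row that is best for \<open>\<mu>\<close> need not be best for \<open>\<kappa>\<close>, but its cost bounds the minimum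
  for \<open>\<kappa>\<close>. So a comparison row by row is enough.
\<close>

lemma kpod_cost_le_affine:
  assumes "\<And>l. row_cost r x (\<kappa> $ l) \<le> a * row_cost r x (\<mu> $ l) + b"
  shows "kpod_cost r x \<kappa> \<le> a * kpod_cost r x \<mu> + b"
proof -
  obtain l where l: "kpod_cost r x \<mu> = row_cost r x (\<mu> $ l)"
    using kpod_cost_attained by blast
  show ?thesis
    using kpod_cost_le_row[of r x \<kappa> l] assms[of l] by (simp add: l)
qed

text \<open>
  The relation is uniform in the observation pattern and in the data point, so that it passes
  to averages over any distribution of patterns and bounded data points. This holds for the
  empirical and the expected loss alike, see \<open>respects_domination\<close> below.
\<close>

definition almost_dominates :: "real \<Rightarrow> real \<Rightarrow> real ^ 'p ^ 'k \<Rightarrow> real ^ 'p ^ 'k \<Rightarrow> bool" where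
  "almost_dominates C \<delta> \<kappa> \<mu> \<longleftrightarrow> (\<forall>r x. obs_mask r \<longrightarrow> norm x \<le> C \<longrightarrow>
      kpod_cost r x \<kappa> \<le> (1 + \<delta>) * kpod_cost r x \<mu> + (\<delta> + \<delta>\<^sup>2))"

lemma almost_dominates_near:
  fixes \<kappa> \<mu> :: "real ^ 'p ^ 'k"
  assumes \<delta>: "\<delta> > 0" and near: "norm (\<kappa> - \<mu>) \<le> \<delta>"
  shows "almost_dominates C \<delta> \<kappa> \<mu>"
  unfolding almost_dominates_def
proof (intro allI impI kpod_cost_le_affine row_cost_perturb \<delta>)
  fix r x :: "real ^ 'p" and l
  assume r: "obs_mask r"
  have "(\<Sum>j\<in>UNIV. r $ j * (\<kappa> $ l $ j - \<mu> $ l $ j)\<^sup>2) = row_cost r (\<kappa> $ l) (\<mu> $ l)"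
    by (simp add: row_cost_def)
  also have "\<dots> \<le> (norm (\<kappa> $ l - \<mu> $ l))\<^sup>2"
    by (rule row_cost_le_norm[OF r])
  also have "\<dots> \<le> \<delta>\<^sup>2"
    using Finite_Cartesian_Product.norm_nth_le[of "\<kappa> - \<mu>" l] near by (intro power_mono) auto
  finally show "(\<Sum>j\<in>UNIV. r $ j * (\<kappa> $ l $ j - \<mu> $ l $ j)\<^sup>2) \<le> \<delta>\<^sup>2" .
qed

text \<open>
  The entries of \<open>\<mu>\<close> that are not close to those of \<open>\<kappa>\<close> only have to be large. A row in which
  such an entry is observed is more expensive for \<open>\<mu>\<close> than any row of \<open>\<kappa>\<close> can be, because
  \<open>\<bar>x\<^sub>j - \<mu>\<^sub>l\<^sub>j\<bar> \<ge> C + norm \<kappa>\<close>. In every other row only close entries are observed,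
  and the squares of up to \<open>CARD('p)\<close> differences add up to at most \<open>\<delta>\<^sup>2\<close>.
\<close>

lemma almost_dominates_of_entries:
  fixes \<kappa> \<mu> :: "real ^ 'p ^ 'k"
  assumes \<delta>: "\<delta> > 0" and C: "C \<ge> 0"
    and entries: "\<And>l j. \<bar>\<kappa> $ l $ j - \<mu> $ l $ j\<bar> \<le> \<delta> / sqrt (real CARD('p))
      \<or> \<bar>\<mu> $ l $ j\<bar> \<ge> 2 * C + norm \<kappa>"
  shows "almost_dominates C \<delta> \<kappa> \<mu>"
  unfolding almost_dominates_def
proof (intro allI impI kpod_cost_le_affine)
  fix r x :: "real ^ 'p" and l
  assume r: "obs_mask r" and x: "norm x \<le> C"
  show "row_cost r x (\<kappa> $ l) \<le> (1 + \<delta>) * row_cost r x (\<mu> $ l) + (\<delta> + \<delta>\<^sup>2)"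
  proof (cases "\<exists>j. r $ j = 1 \<and> \<bar>\<mu> $ l $ j\<bar> \<ge> 2 * C + norm \<kappa>")
    case True
    then obtain j where j: "r $ j = 1" "\<bar>\<mu> $ l $ j\<bar> \<ge> 2 * C + norm \<kappa>" by auto
    have "norm (x - \<kappa> $ l) \<le> C + norm \<kappa>"
      using norm_triangle_ineq4[of x "\<kappa> $ l"] Finite_Cartesian_Product.norm_nth_le[of \<kappa> l] x by linarith
    moreover have "C + norm \<kappa> \<le> \<bar>x $ j - \<mu> $ l $ j\<bar>"
      using j(2) x component_le_norm_cart[of x j] by linarith
    ultimately have "(norm (x - \<kappa> $ l))\<^sup>2 \<le> \<bar>x $ j - \<mu> $ l $ j\<bar>\<^sup>2"
      by (intro power_mono) auto
    then have "row_cost r x (\<kappa> $ l) \<le> r $ j * (x $ j - \<mu> $ l $ j)\<^sup>2"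
      using row_cost_le_norm[OF r, of x "\<kappa> $ l"] j(1) by simp
    also have "\<dots> \<le> row_cost r x (\<mu> $ l)"
      unfolding row_cost_def
      by (intro member_le_sum mult_nonneg_nonneg obs_mask_nonneg r) auto
    also have "\<dots> \<le> (1 + \<delta>) * row_cost r x (\<mu> $ l) + (\<delta> + \<delta>\<^sup>2)"
      using \<delta> row_cost_nonneg[OF r, of x "\<mu> $ l"] by (simp add: ring_distribs)
    finally show ?thesis .
  next
    case False
    have "r $ j * (\<kappa> $ l $ j - \<mu> $ l $ j)\<^sup>2 \<le> \<delta>\<^sup>2 / real CARD('p)" for j
    proof (cases "r $ j = 1")
      case True
      then have "\<bar>\<kappa> $ l $ j - \<mu> $ l $ j\<bar>\<^sup>2 \<le> (\<delta> / sqrt (real CARD('p)))\<^sup>2"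
        using entries[of l j] False by (intro power_mono) auto
      then show ?thesis using True by (simp add: power_divide)
    next
      case False
      then show ?thesis using obs_mask_cases[OF r, of j] by simp
    qed
    then have "(\<Sum>j\<in>UNIV. r $ j * (\<kappa> $ l $ j - \<mu> $ l $ j)\<^sup>2)
        \<le> (\<Sum>j\<in>(UNIV :: 'p set). \<delta>\<^sup>2 / real CARD('p))"
      by (intro sum_mono)
    also have "\<dots> = \<delta>\<^sup>2" by simp
    finally show ?thesis by (intro row_cost_perturb r \<delta>)
  qed
qed

section \<open>Compactness for sequences of center matrices\<close>

lemma tendsto_or_at_infinity_of_arctan:
  fixes u :: "nat \<Rightarrow> real"
  assumes lim: "(\<lambda>n. arctan (u n)) \<longlonglongrightarrow> a"
  shows "(\<exists>v. u \<longlonglongrightarrow> v) \<or> filterlim (\<lambda>n. \<bar>u n\<bar>) at_top sequentially"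
proof -
  have "a \<le> pi / 2"
    by (rule tendsto_upperbound[OF lim]) (intro always_eventually allI less_imp_le arctan_ubound, simp)
  moreover have "- (pi / 2) \<le> a"
    by (rule tendsto_lowerbound[OF lim]) (intro always_eventually allI less_imp_le arctan_lbound, simp)
  ultimately consider "a = pi / 2" | "a = - (pi / 2)" | "- (pi / 2) < a" "a < pi / 2"
    by linarith
  then show ?thesis
  proof cases
    case 1
    have "\<forall>\<^sub>F n in sequentially. B \<le> \<bar>u n\<bar>" for B
      using order_tendstoD(1)[OF lim, of "arctan B"] arctan_ubound[of B] 1
      by (auto simp: arctan_less_iff elim!: eventually_mono)
    then show ?thesis by (simp add: filterlim_at_top)
  next
    case 2
    have "\<forall>\<^sub>F n in sequentially. B \<le> \<bar>u n\<bar>" for B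
      using order_tendstoD(2)[OF lim, of "arctan (- B)"] arctan_lbound[of "- B"] 2
      by (auto simp: arctan_less_iff simp del: arctan_minus elim!: eventually_mono)
    then show ?thesis by (simp add: filterlim_at_top)
  next
    case 3
    have "(\<lambda>n. tan (arctan (u n))) \<longlonglongrightarrow> tan a"
      using cos_gt_zero_pi[of a] 3 by (intro isCont_tendsto_compose[OF isCont_tan lim]) simp
    then show ?thesis by (auto simp: tan_arctan)
  qed
qed

text \<open>
  Applying \<open>arctan\<close> to every entry makes the sequence bounded, which gives a subsequence along
  which each entry converges in the extended reals.
\<close>

lemma subseq_entries_tendsto_or_at_infinity:
  fixes \<mu> :: "nat \<Rightarrow> real ^ 'p ^ 'k"
  obtains s :: "nat \<Rightarrow> nat" where "strict_mono s"
    and "\<And>l j. (\<exists>v. (\<lambda>n. \<mu> (s n) $ l $ j) \<longlonglongrightarrow> v)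
      \<or> filterlim (\<lambda>n. \<bar>\<mu> (s n) $ l $ j\<bar>) at_top sequentially"
proof -
  define \<phi> :: "nat \<Rightarrow> real ^ 'p ^ 'k" where "\<phi> n = (\<chi> l j. arctan (\<mu> n $ l $ j))" for n
  have "norm (\<phi> n) \<le> (\<Sum>l\<in>(UNIV :: 'k set). \<Sum>j\<in>(UNIV :: 'p set). pi / 2)" for n
  proof -
    have "norm (\<phi> n) \<le> (\<Sum>l\<in>UNIV. norm (\<phi> n $ l))"
      by (simp add: norm_vec_def L2_set_le_sum)
    also have "\<dots> \<le> (\<Sum>l\<in>(UNIV :: 'k set). \<Sum>j\<in>(UNIV :: 'p set). \<bar>\<phi> n $ l $ j\<bar>)"
      by (intro sum_mono norm_le_l1_cart)
    also have "\<dots> \<le> (\<Sum>l\<in>(UNIV :: 'k set). \<Sum>j\<in>(UNIV :: 'p set). pi / 2)"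
    proof (intro sum_mono)
      fix l j
      show "\<bar>\<phi> n $ l $ j\<bar> \<le> pi / 2"
        using arctan_ubound[of "\<mu> n $ l $ j"] arctan_lbound[of "\<mu> n $ l $ j"]
        by (simp add: \<phi>_def abs_le_iff)
    qed
    finally show ?thesis .
  qed
  then have "bounded (range \<phi>)"
    unfolding bounded_iff by blast
  then obtain s \<phi>' where s: "strict_mono s" and lim: "(\<phi> \<circ> s) \<longlonglongrightarrow> \<phi>'"
    using bounded_imp_convergent_subsequence by blast
  have arctan_lim: "(\<lambda>n. arctan (\<mu> (s n) $ l $ j)) \<longlonglongrightarrow> \<phi>' $ l $ j" for l j
    using tendsto_vec_nth[OF tendsto_vec_nth[OF lim], of l j] by (simp add: \<phi>_def o_def)
  show ?thesis
    by (rule that[OF s tendsto_or_at_infinity_of_arctan[OF arctan_lim]])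
qed

text \<open>
  The substitute for compactness of the parameter space. The matrix \<open>\<kappa> m\<close> has the limits in
  the places where the entries converge; in the other places it copies \<open>\<mu> (s m)\<close>, so that it
  stays close to \<open>\<mu> (s m)\<close>. Every such filling of the divergent places is asymptotically no
  more costly than the sequence itself, because there the sequence pays ever more for an
  observed entry.
\<close>

lemma subseq_with_almost_dominating_fillins:
  fixes \<mu> :: "nat \<Rightarrow> real ^ 'p ^ 'k"
  assumes C: "C \<ge> 0"
  obtains s :: "nat \<Rightarrow> nat" and \<kappa> :: "nat \<Rightarrow> real ^ 'p ^ 'k" where "strict_mono s"
    and "(\<lambda>n. \<mu> (s n) - \<kappa> n) \<longlonglongrightarrow> 0"
    and "\<And>m \<delta>. \<delta> > 0 \<Longrightarrow> \<forall>\<^sub>F n in sequentially. almost_dominates C \<delta> (\<kappa> m) (\<mu> (s n))"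
proof -
  obtain s :: "nat \<Rightarrow> nat" where s: "strict_mono s"
    and entry: "\<And>l j. (\<exists>v. (\<lambda>n. \<mu> (s n) $ l $ j) \<longlonglongrightarrow> v)
      \<or> filterlim (\<lambda>n. \<bar>\<mu> (s n) $ l $ j\<bar>) at_top sequentially"
    using subseq_entries_tendsto_or_at_infinity by blast
  define conv where "conv l j \<longleftrightarrow> convergent (\<lambda>n. \<mu> (s n) $ l $ j)" for l j
  define \<kappa> :: "nat \<Rightarrow> real ^ 'p ^ 'k" where
    "\<kappa> m = (\<chi> l j. if conv l j then lim (\<lambda>n. \<mu> (s n) $ l $ j) else \<mu> (s m) $ l $ j)" for m
  have conv_lim: "(\<lambda>n. \<mu> (s n) $ l $ j) \<longlonglongrightarrow> \<kappa> m $ l $ j" if "conv l j" for l j m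
    using that by (simp add: \<kappa>_def conv_def convergent_LIMSEQ_iff)
  have "(\<lambda>n. (\<mu> (s n) - \<kappa> n) $ l $ j) \<longlonglongrightarrow> 0" for l j
  proof (cases "conv l j")
    case True
    define v where "v = lim (\<lambda>n. \<mu> (s n) $ l $ j)"
    have "\<kappa> n $ l $ j = v" for n
      using True by (simp add: \<kappa>_def v_def)
    then show ?thesis
      using LIM_zero[OF conv_lim[OF True, of 0]] by simp
  next
    case False
    then show ?thesis by (simp add: \<kappa>_def)
  qed
  then have "(\<lambda>n. \<mu> (s n) - \<kappa> n) \<longlonglongrightarrow> 0"
    by (intro vec_tendstoI) (simp add: vec_tendstoI)
  moreover have "\<forall>\<^sub>F n in sequentially. almost_dominates C \<delta> (\<kappa> m) (\<mu> (s n))"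
    if \<delta>: "\<delta> > 0" for m \<delta>
  proof -
    let ?B = "2 * C + norm (\<kappa> m)" and ?\<eta> = "\<delta> / sqrt (real CARD('p))"
    have "\<forall>\<^sub>F n in sequentially.
        \<bar>\<kappa> m $ l $ j - \<mu> (s n) $ l $ j\<bar> \<le> ?\<eta> \<or> \<bar>\<mu> (s n) $ l $ j\<bar> \<ge> ?B" for l j
    proof (cases "conv l j")
      case True
      have "?\<eta> > 0" using \<delta> by simp
      from tendstoD[OF conv_lim[OF True, of m] this] show ?thesis
        by (auto simp: dist_real_def abs_minus_commute elim!: eventually_mono)
    next
      case False
      then have "filterlim (\<lambda>n. \<bar>\<mu> (s n) $ l $ j\<bar>) at_top sequentially"
        using entry[of l j] by (auto simp: conv_def convergent_def)
      then have "\<forall>\<^sub>F n in sequentially. \<bar>\<mu> (s n) $ l $ j\<bar> \<ge> ?B"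
        by (simp add: filterlim_at_top)
      then show ?thesis by (rule eventually_mono) simp
    qed
    then have "\<forall>\<^sub>F n in sequentially. \<forall>l j.
        \<bar>\<kappa> m $ l $ j - \<mu> (s n) $ l $ j\<bar> \<le> ?\<eta> \<or> \<bar>\<mu> (s n) $ l $ j\<bar> \<ge> ?B"
      by (simp add: eventually_all_finite)
    then show ?thesis
      by (rule eventually_mono) (rule almost_dominates_of_entries[OF \<delta> C], blast)
  qed
  ultimately show ?thesis by (rule that[OF s])
qed

section \<open>Minimizers of losses that respect domination\<close>

text \<open>
  All comparisons below carry the error terms of \<open>almost_dominates\<close>, and some carry a further
  \<open>\<delta>\<close> because minimality holds only up to an error. They vanish together as \<open>\<delta>\<close> tends
  to \<open>0\<close>.
\<close>

lemma le_of_le_perturbed: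
  fixes a b :: real
  assumes "\<And>\<delta>. \<delta> > 0 \<Longrightarrow> a \<le> (1 + \<delta>) * (b + \<delta>) + (\<delta> + \<delta>\<^sup>2)"
  shows "a \<le> b"
proof (rule tendsto_lowerbound)
  show "((\<lambda>\<delta>. (1 + \<delta>) * (b + \<delta>) + (\<delta> + \<delta>\<^sup>2)) \<longlongrightarrow> b) (at_right 0)"
    by (auto intro!: tendsto_eq_intros)
  show "\<forall>\<^sub>F \<delta> in at_right 0. a \<le> (1 + \<delta>) * (b + \<delta>) + (\<delta> + \<delta>\<^sup>2)"
    using eventually_at_right_less[of "0 :: real"] by eventually_elim (rule assms)
qed simp

text \<open>
  This property captures all that the deterministic part of the argument uses about the
  empirical and the expected loss. Since nearby matrices almost dominate each other, it
  contains a form of continuity.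
\<close>

definition respects_domination :: "real \<Rightarrow> (real ^ 'p ^ 'k \<Rightarrow> real) \<Rightarrow> bool" where
  "respects_domination C f \<longleftrightarrow> (\<forall>\<delta>>0. \<forall>\<kappa> \<mu>. almost_dominates C \<delta> \<kappa> \<mu> \<longrightarrow>
      f \<kappa> \<le> (1 + \<delta>) * f \<mu> + (\<delta> + \<delta>\<^sup>2))"

lemma respects_dominationD:
  assumes "respects_domination C f" "\<delta> > 0" "almost_dominates C \<delta> \<kappa> \<mu>"
  shows "f \<kappa> \<le> (1 + \<delta>) * f \<mu> + (\<delta> + \<delta>\<^sup>2)"
  using assms unfolding respects_domination_def by blast

lemma respects_domination_near:
  assumes "respects_domination C f" "\<delta> > 0" "norm (\<kappa> - \<mu>) \<le> \<delta>"
  shows "f \<kappa> \<le> (1 + \<delta>) * f \<mu> + (\<delta> + \<delta>\<^sup>2)"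
  using assms respects_dominationD almost_dominates_near by blast

lemma argmin_set_iff: "x \<in> argmin_set f \<longleftrightarrow> (\<forall>y. f x \<le> f y)"
  by (simp add: argmin_set_def is_arg_min_linorder)

text \<open>
  The limit matrices to which the convergence is applied depend on the random outcome. An
  almost sure statement therefore has to hold for all matrices at once, while the strong law
  of large numbers yields it for countably many only. The estimate for nearby matrices is
  the equicontinuity that closes this gap.
\<close>

lemma tendsto_of_tendsto_on_dense:
  fixes f :: "nat \<Rightarrow> real ^ 'p ^ 'k \<Rightarrow> real"
  assumes f: "\<forall>\<^sub>F n in sequentially. respects_domination C (f n)" and F: "respects_domination C F"
    and dense: "\<And>U. open U \<Longrightarrow> U \<noteq> {} \<Longrightarrow> \<exists>\<nu>\<in>D. \<nu> \<in> U"
    and conv: "\<And>\<nu>. \<nu> \<in> D \<Longrightarrow> (\<lambda>n. f n \<nu>) \<longlonglongrightarrow> F \<nu>"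
  shows "(\<lambda>n. f n \<mu>) \<longlonglongrightarrow> F \<mu>"
proof -
  define c where "c \<delta> = \<delta> + \<delta>\<^sup>2" for \<delta> :: real
  have nearby: "\<exists>\<nu>\<in>D. norm (\<mu> - \<nu>) \<le> \<delta> \<and> norm (\<nu> - \<mu>) \<le> \<delta>" if "\<delta> > 0" for \<delta>
    using dense[of "ball \<mu> \<delta>"] that by (force simp: dist_norm norm_minus_commute)
  show ?thesis
  proof (rule order_tendstoI)
    fix a assume a: "F \<mu> < a"
    \<comment> \<open>The bound that arises when the estimate for nearby matrices is applied twice: from \<open>f n \<mu>\<close>
      to \<open>f n \<nu>\<close>, and from \<open>F \<nu>\<close> to \<open>F \<mu>\<close>.\<close>
    have "((\<lambda>\<delta>. (1 + \<delta>) * ((1 + \<delta>) * F \<mu> + c \<delta>) + c \<delta>) \<longlongrightarrow> F \<mu>) (at_right 0)"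
      unfolding c_def by (auto intro!: tendsto_eq_intros)
    from order_tendstoD(2)[OF this a]
    have "\<forall>\<^sub>F \<delta> in at_right 0. \<delta> > 0 \<and> (1 + \<delta>) * ((1 + \<delta>) * F \<mu> + c \<delta>) + c \<delta> < a"
      using eventually_at_right_less[of "0 :: real"] by eventually_elim auto
    then obtain \<delta> where \<delta>: "\<delta> > 0" "(1 + \<delta>) * ((1 + \<delta>) * F \<mu> + c \<delta>) + c \<delta> < a"
      using eventually_happens by force
    obtain \<nu> where \<nu>: "\<nu> \<in> D" "norm (\<mu> - \<nu>) \<le> \<delta>" "norm (\<nu> - \<mu>) \<le> \<delta>"
      using nearby[OF \<delta>(1)] by blast
    have le: "(1 + \<delta>) * F \<nu> + c \<delta> \<le> (1 + \<delta>) * ((1 + \<delta>) * F \<mu> + c \<delta>) + c \<delta>"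
      using respects_domination_near[OF F \<delta>(1) \<nu>(3)] \<delta>(1)
      by (intro add_right_mono mult_left_mono) (auto simp: c_def)
    have lim: "(\<lambda>n. (1 + \<delta>) * f n \<nu> + c \<delta>) \<longlonglongrightarrow> (1 + \<delta>) * F \<nu> + c \<delta>"
      by (intro tendsto_intros conv \<nu>)
    have "\<forall>\<^sub>F n in sequentially. (1 + \<delta>) * f n \<nu> + c \<delta> < a"
      by (rule order_tendstoD(2)[OF lim]) (use le \<delta>(2) in linarith)
    with f show "\<forall>\<^sub>F n in sequentially. f n \<mu> < a"
    proof eventually_elim
      case (elim n)
      then show ?case
        using respects_domination_near[OF elim(1) \<delta>(1) \<nu>(2)] by (simp add: c_def)
    qed
  next
    fix a assume a: "a < F \<mu>"
    \<comment> \<open>Here the estimate leads from \<open>F \<mu>\<close> to \<open>F \<nu>\<close>, and from \<open>f n \<nu>\<close> to \<open>f n \<mu>\<close>.\<close>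
    have "((\<lambda>\<delta>. (1 + \<delta>) * ((1 + \<delta>) * a + c \<delta>) + c \<delta>) \<longlongrightarrow> a) (at_right 0)"
      unfolding c_def by (auto intro!: tendsto_eq_intros)
    from order_tendstoD(2)[OF this a]
    have "\<forall>\<^sub>F \<delta> in at_right 0. \<delta> > 0 \<and> (1 + \<delta>) * ((1 + \<delta>) * a + c \<delta>) + c \<delta> < F \<mu>"
      using eventually_at_right_less[of "0 :: real"] by eventually_elim auto
    then obtain \<delta> where \<delta>: "\<delta> > 0" "(1 + \<delta>) * ((1 + \<delta>) * a + c \<delta>) + c \<delta> < F \<mu>"
      using eventually_happens by force
    obtain \<nu> where \<nu>: "\<nu> \<in> D" "norm (\<mu> - \<nu>) \<le> \<delta>" "norm (\<nu> - \<mu>) \<le> \<delta>"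
      using nearby[OF \<delta>(1)] by blast
    have "(1 + \<delta>) * ((1 + \<delta>) * a + c \<delta>) < (1 + \<delta>) * F \<nu>"
      using respects_domination_near[OF F \<delta>(1) \<nu>(2)] \<delta>(2) by (simp add: c_def)
    then have "(1 + \<delta>) * a + c \<delta> < F \<nu>"
      using \<delta>(1) by simp
    from order_tendstoD(1)[OF conv[OF \<nu>(1)] this] f
    show "\<forall>\<^sub>F n in sequentially. a < f n \<mu>"
    proof eventually_elim
      case (elim n)
      then have "(1 + \<delta>) * a < (1 + \<delta>) * f n \<mu>"
        using respects_domination_near[OF elim(2) \<delta>(1) \<nu>(3)] by (simp add: c_def)
      then show ?case using \<delta>(1) by simp
    qed
  qed
qed

text \<open>
  Let \<open>\<kappa> i\<close> be the fillings of a subsequence of \<open>m\<close>. For fixed \<open>i\<close>,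
  domination gives \<open>f n (\<kappa> i) \<le> f n (m n) \<le> F \<nu>\<close> up to small errors along the subsequence,
  and the left-hand side converges to \<open>F (\<kappa> i)\<close>. Since \<open>\<kappa> i\<close> is fixed, pointwise convergence of \<open>f\<close>
  is enough for this.
\<close>

lemma subseq_close_to_minimizers:
  fixes f :: "nat \<Rightarrow> real ^ 'p ^ 'k \<Rightarrow> real"
  assumes C: "C \<ge> 0" and f: "\<forall>\<^sub>F n in sequentially. respects_domination C (f n)"
    and conv: "\<And>\<mu>. (\<lambda>n. f n \<mu>) \<longlonglongrightarrow> F \<mu>"
    and near_min: "\<And>\<nu> \<epsilon>. \<epsilon> > 0 \<Longrightarrow> \<forall>\<^sub>F n in sequentially. f n (m n) \<le> F \<nu> + \<epsilon>"
  obtains s :: "nat \<Rightarrow> nat" and \<kappa> where "strict_mono s" "(\<lambda>n. m (s n) - \<kappa> n) \<longlonglongrightarrow> 0"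
    "\<And>n. \<kappa> n \<in> argmin_set F"
proof -
  obtain s \<kappa> where s: "strict_mono s" and close: "(\<lambda>n. m (s n) - \<kappa> n) \<longlonglongrightarrow> 0"
    and dom: "\<And>i \<delta>. \<delta> > 0 \<Longrightarrow> \<forall>\<^sub>F n in sequentially. almost_dominates C \<delta> (\<kappa> i) (m (s n))"
    using subseq_with_almost_dominating_fillins[OF C, of m] by blast
  have sub: "filterlim s sequentially sequentially"
    using s by (rule filterlim_subseq)
  have "F (\<kappa> i) \<le> F \<nu>" for i \<nu>
  proof (rule le_of_le_perturbed)
    fix \<delta> :: real assume \<delta>: "\<delta> > 0"
    have "\<forall>\<^sub>F n in sequentially. f (s n) (\<kappa> i) \<le> (1 + \<delta>) * (F \<nu> + \<delta>) + (\<delta> + \<delta>\<^sup>2)"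
      using dom[OF \<delta>, of i] eventually_compose_filterlim[OF f sub]
        eventually_compose_filterlim[OF near_min[OF \<delta>, of \<nu>] sub]
    proof eventually_elim
      case (elim n)
      have "(1 + \<delta>) * f (s n) (m (s n)) \<le> (1 + \<delta>) * (F \<nu> + \<delta>)"
        using elim(3) \<delta> by (intro mult_left_mono) auto
      then show ?case
        using respects_dominationD[OF elim(2) \<delta> elim(1)] by linarith
    qed
    then show "F (\<kappa> i) \<le> (1 + \<delta>) * (F \<nu> + \<delta>) + (\<delta> + \<delta>\<^sup>2)"
      by (intro tendsto_upperbound[OF filterlim_compose[OF conv sub]]) auto
  qed
  then show ?thesis
    by (intro that[OF s close]) (simp add: argmin_set_iff)
qed

text \<open>
  This is \<open>subseq_close_to_minimizers\<close> for the constant sequence \<open>F\<close> and a minimizing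
  sequence \<open>m\<close>.
\<close>

lemma argmin_set_nonempty:
  fixes F :: "real ^ 'p ^ 'k \<Rightarrow> real"
  assumes C: "C \<ge> 0" and F: "respects_domination C F" and bdd: "bdd_below (range F)"
  shows "argmin_set F \<noteq> {}"
proof -
  have "\<exists>\<mu>. F \<mu> < Inf (range F) + 1 / real (Suc n)" for n
    using cInf_lessD[of "range F" "Inf (range F) + 1 / real (Suc n)"] by auto
  then obtain m where m: "\<And>n. F (m n) < Inf (range F) + 1 / real (Suc n)"
    by metis
  have near_min: "\<forall>\<^sub>F n in sequentially. F (m n) \<le> F \<nu> + \<epsilon>" if \<epsilon>: "\<epsilon> > 0" for \<nu> \<epsilon>
  proof -
    have "\<forall>\<^sub>F n in sequentially. 1 / real (Suc n) < \<epsilon>"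
      using order_tendstoD(2)[OF LIMSEQ_Suc[OF lim_1_over_n] \<epsilon>] by simp
    then show ?thesis
    proof eventually_elim
      case (elim n)
      have "Inf (range F) \<le> F \<nu>"
        by (intro cInf_lower bdd) auto
      with m[of n] elim show ?case by linarith
    qed
  qed
  show ?thesis
    by (rule subseq_close_to_minimizers[OF C, of "\<lambda>_. F" F m]) (use F near_min in auto)
qed

lemma closed_argmin_set:
  assumes F: "respects_domination C F"
  shows "closed (argmin_set F)"
proof -
  have "\<kappa> \<in> argmin_set F" if \<kappa>: "\<kappa> \<in> closure (argmin_set F)" for \<kappa>
    unfolding argmin_set_iff
  proof (rule allI, rule le_of_le_perturbed)
    fix \<nu> and \<delta> :: real assume \<delta>: "\<delta> > 0"
    then obtain \<mu> where \<mu>: "\<mu> \<in> argmin_set F" "dist \<mu> \<kappa> < \<delta>"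
      using \<kappa> by (auto simp: closure_approachable)
    have "F \<kappa> \<le> (1 + \<delta>) * F \<mu> + (\<delta> + \<delta>\<^sup>2)"
      using \<mu>(2) by (intro respects_domination_near[OF F \<delta>]) (simp add: dist_norm norm_minus_commute)
    also have "\<dots> \<le> (1 + \<delta>) * (F \<nu> + \<delta>) + (\<delta> + \<delta>\<^sup>2)"
    proof (intro add_right_mono mult_left_mono)
      have "F \<mu> \<le> F \<nu>" using \<mu>(1) by (simp add: argmin_set_iff)
      then show "F \<mu> \<le> F \<nu> + \<delta>" using \<delta> by linarith
    qed (use \<delta> in auto)
    finally show "F \<kappa> \<le> (1 + \<delta>) * (F \<nu> + \<delta>) + (\<delta> + \<delta>\<^sup>2)" .
  qed
  then show ?thesis
    by (metis closure_subset_eq subsetI)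
qed

text \<open>
  If the distances did not tend to zero, they would stay above some \<open>e\<close> along a subsequence;
  but a further subsequence comes close to the set of minimizers.
\<close>

lemma infdist_argmin_set_tendsto_0:
  fixes f :: "nat \<Rightarrow> real ^ 'p ^ 'k \<Rightarrow> real"
  assumes C: "C \<ge> 0" and f: "\<forall>\<^sub>F n in sequentially. respects_domination C (f n)"
    and conv: "\<And>\<mu>. (\<lambda>n. f n \<mu>) \<longlonglongrightarrow> F \<mu>"
    and min: "\<forall>\<^sub>F n in sequentially. m n \<in> argmin_set (f n)"
  shows "(\<lambda>n. infdist (m n) (argmin_set F)) \<longlonglongrightarrow> 0"
proof (rule ccontr)
  assume "\<not> ?thesis"
  then obtain e where e: "e > 0"
    and "\<not> (\<forall>\<^sub>F n in sequentially. infdist (m n) (argmin_set F) < e)"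
    by (auto simp: tendsto_iff dist_real_def infdist_nonneg)
  then obtain t :: "nat \<Rightarrow> nat" where t: "strict_mono t" and far: "\<forall>n. infdist (m (t n)) (argmin_set F) \<ge> e"
    using not_eventually_sequentiallyD[of "\<lambda>n. infdist (m n) (argmin_set F) < e"]
    unfolding not_less by blast
  have sub: "filterlim t sequentially sequentially"
    using t by (rule filterlim_subseq)
  have "\<forall>\<^sub>F n in sequentially. f n (m n) \<le> F \<nu> + \<epsilon>" if \<epsilon>: "\<epsilon> > 0" for \<nu> \<epsilon>
  proof -
    have "\<forall>\<^sub>F n in sequentially. f n \<nu> < F \<nu> + \<epsilon>"
      using \<epsilon> by (intro order_tendstoD(2)[OF conv]) simp
    with min show ?thesis
    proof eventually_elim
      case (elim n)
      from elim(1) have "f n (m n) \<le> f n \<nu>"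
        by (simp add: argmin_set_iff)
      with elim(2) show ?case by linarith
    qed
  qed
  then have near_min: "\<forall>\<^sub>F n in sequentially. f (t n) (m (t n)) \<le> F \<nu> + \<epsilon>"
    if "\<epsilon> > 0" for \<nu> \<epsilon>
    using eventually_compose_filterlim[OF _ sub] that by blast
  obtain s \<kappa> where s: "strict_mono (s :: nat \<Rightarrow> nat)"
    and close: "(\<lambda>n. m (t (s n)) - \<kappa> n) \<longlonglongrightarrow> 0" and \<kappa>: "\<And>n. \<kappa> n \<in> argmin_set F"
    using subseq_close_to_minimizers[OF C eventually_compose_filterlim[OF f sub]
        filterlim_compose[OF conv sub] near_min] by metis
  obtain n where "norm (m (t (s n)) - \<kappa> n) < e"
    using tendstoD[OF close e] by (auto simp: eventually_sequentially)
  moreover have "infdist (m (t (s n))) (argmin_set F) \<le> norm (m (t (s n)) - \<kappa> n)"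
    using infdist_le[OF \<kappa>] by (simp add: dist_norm)
  ultimately show False using far[rule_format, of "s n"] by linarith
qed

text \<open>
  \<open>F\<close> is not uniformly continuous, and the set of minimizers may be unbounded. But near a
  minimizer \<open>\<kappa>\<close> the error in the domination estimate depends on \<open>\<kappa>\<close> only through \<open>F \<kappa>\<close>,
  which is the same for all minimizers.
\<close>

lemma tendsto_INF_of_infdist_argmin_set:
  assumes F: "respects_domination C F" and ne: "argmin_set F \<noteq> {}"
    and dist: "(\<lambda>n. infdist (m n) (argmin_set F)) \<longlonglongrightarrow> 0"
  shows "(\<lambda>n. F (m n)) \<longlonglongrightarrow> (INF \<mu>. F \<mu>)"
proof -
  obtain \<mu>0 where \<mu>0: "\<And>\<mu>. F \<mu>0 \<le> F \<mu>"
    using ne unfolding argmin_set_iff ex_in_conv[symmetric] by blast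
  have INF: "(INF \<mu>. F \<mu>) = F \<mu>0"
    by (intro cInf_eq_minimum) (auto simp: \<mu>0)
  show ?thesis
    unfolding INF
  proof (rule order_tendstoI)
    fix a assume "a < F \<mu>0"
    then show "\<forall>\<^sub>F n in sequentially. a < F (m n)"
      using \<mu>0 by (intro always_eventually) (meson less_le_trans)
  next
    fix a assume a: "F \<mu>0 < a"
    have "((\<lambda>\<delta>. (1 + \<delta>) * F \<mu>0 + (\<delta> + \<delta>\<^sup>2)) \<longlongrightarrow> F \<mu>0) (at_right 0)"
      by (auto intro!: tendsto_eq_intros)
    from order_tendstoD(2)[OF this a]
    have "\<forall>\<^sub>F \<delta> in at_right 0. \<delta> > 0 \<and> (1 + \<delta>) * F \<mu>0 + (\<delta> + \<delta>\<^sup>2) < a"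
      using eventually_at_right_less[of "0 :: real"] by eventually_elim auto
    then obtain \<delta> where \<delta>: "\<delta> > 0" "(1 + \<delta>) * F \<mu>0 + (\<delta> + \<delta>\<^sup>2) < a"
      using eventually_happens by force
    from order_tendstoD(2)[OF dist \<delta>(1)]
    show "\<forall>\<^sub>F n in sequentially. F (m n) < a"
    proof eventually_elim
      case (elim n)
      obtain \<kappa> where \<kappa>: "\<kappa> \<in> argmin_set F" "infdist (m n) (argmin_set F) = dist (m n) \<kappa>"
        using infdist_attains_inf[OF closed_argmin_set[OF F] ne] by blast
      have "F \<kappa> = F \<mu>0"
        using \<kappa>(1) \<mu>0 by (auto simp: argmin_set_iff intro: antisym)
      then have "F (m n) \<le> (1 + \<delta>) * F \<mu>0 + (\<delta> + \<delta>\<^sup>2)"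
        using respects_domination_near[OF F \<delta>(1), of "m n" \<kappa>] elim \<kappa>(2) by (simp add: dist_norm)
      with \<delta>(2) show ?case by linarith
    qed
  qed
qed

section \<open>A strong law of large numbers for bounded variables\<close>

text \<open>
  By Hoeffding's inequality the probability that the mean of \<open>n\<close> variables is off by \<open>e\<close> is at
  most \<open>2 * q ^ n\<close> with some \<open>q < 1\<close>. This is summable, so the Borel-Cantelli lemma applies for
  each \<open>e = 1 / (m + 1)\<close>.
\<close>

lemma (in prob_space) strong_law_bounded:
  fixes Z :: "nat \<Rightarrow> 'a \<Rightarrow> real"
  assumes indep: "indep_vars (\<lambda>_. borel) Z UNIV"
    and distr: "\<And>i. distr M borel (Z i) = distr M borel (Z 0)"
    and bounded: "AE \<omega> in M. \<bar>Z 0 \<omega>\<bar> \<le> B"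
  shows "AE \<omega> in M. (\<lambda>n. 1 / real n * (\<Sum>i<n. Z i \<omega>)) \<longlonglongrightarrow> expectation (Z 0)"
proof -
  \<comment> \<open>Hoeffding's inequality asks for a nondegenerate interval, even if \<open>B = 0\<close>.\<close>
  define b where "b = \<bar>B\<bar> + 1"
  have b: "b > 0" by (simp add: b_def)
  have [measurable]: "random_variable borel (Z i)" for i
    using indep by (auto simp: indep_vars_def)
  have interval: "AE \<omega> in M. Z 0 \<omega> \<in> {- b..b}"
    using bounded by eventually_elim (auto simp: b_def)
  have "AE \<omega> in M. \<forall>\<^sub>F n in sequentially.
      \<bar>1 / real n * (\<Sum>i<n. Z i \<omega>) - expectation (Z 0)\<bar> < e" if e: "e > 0" for e :: real
  proof -
    define A where "A n = {\<omega> \<in> space M.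
      \<bar>(\<Sum>i<Suc n. Z i \<omega>) - real (Suc n) * expectation (Z 0)\<bar> \<ge> real (Suc n) * e}" for n
    define q where "q = exp (- (e\<^sup>2 / (2 * b\<^sup>2)))"
    have "e\<^sup>2 / (2 * b\<^sup>2) > 0"
      using e b by (intro divide_pos_pos mult_pos_pos zero_less_power) auto
    then have q: "0 < q" "q < 1"
      by (simp_all only: q_def exp_gt_zero exp_less_one_iff neg_less_0_iff_less)
    have prob_A: "prob (A n) \<le> 2 * q ^ Suc n" for n
    proof -
      \<comment> \<open>A name of its own for \<open>Z 0\<close>: otherwise the simplification rule
        \<open>expectation (Z i) = expectation (Z 0)\<close> of the locale applies to its own result.\<close>
      define Y where "Y = Z 0"
      interpret Hoeffding_ineq_iid M "{..<Suc n}" Z Y "- b" b "expectation Y"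
      proof unfold_locales
        show "indep_vars (\<lambda>_. borel) Z {..<Suc n}"
          by (rule indep_vars_subset[OF indep]) simp
        show "distr M borel (Z i) = distr M borel Y" for i
          unfolding Y_def by (rule distr)
        show "AE \<omega> in M. Y \<omega> \<in> {- b..b}"
          unfolding Y_def by (rule interval)
      qed (simp_all add: Y_def)
      have "prob (A n) \<le> 2 * exp (- 2 * (real (Suc n) * e)\<^sup>2 / (real (Suc n) * (b - - b)\<^sup>2))"
        using Hoeffding_ineq_abs_ge[of "real (Suc n) * e"] e b unfolding A_def Y_def[symmetric]
        by (simp add: lessThan_empty_iff del: sum.lessThan_Suc of_nat_Suc)
      also have "- 2 * (real (Suc n) * e)\<^sup>2 / (real (Suc n) * (b - - b)\<^sup>2)
          = real (Suc n) * - (e\<^sup>2 / (2 * b\<^sup>2))"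
        using b by (simp add: field_simps power2_eq_square del: of_nat_Suc)
      also have "exp \<dots> = q ^ Suc n"
        unfolding q_def by (rule exp_of_nat_mult)
      finally show ?thesis .
    qed
    have "summable (\<lambda>n. 2 * q ^ Suc n)"
      using q by (intro summable_mult summable_Suc_iff[THEN iffD2] summable_geometric) auto
    then have "summable (\<lambda>n. prob (A n))"
      by (rule summable_comparison_test') (use prob_A in auto)
    moreover have [measurable]: "A n \<in> events" for n
      unfolding A_def by measurable
    ultimately have "AE \<omega> in M. \<forall>\<^sub>F n in sequentially. \<omega> \<in> space M - A n"
      by (intro borel_cantelli_AE1) (auto simp: emeasure_eq_measure)
    then show ?thesis
    proof eventually_elim
      case (elim \<omega>)
      then have "\<forall>\<^sub>F n in sequentially.
          \<bar>1 / real (Suc n) * (\<Sum>i<Suc n. Z i \<omega>) - expectation (Z 0)\<bar> < e"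
      proof eventually_elim
        case (elim n)
        then have "\<bar>(\<Sum>i<Suc n. Z i \<omega>) - real (Suc n) * expectation (Z 0)\<bar> < real (Suc n) * e"
          by (auto simp: A_def)
        also have "(\<Sum>i<Suc n. Z i \<omega>) - real (Suc n) * expectation (Z 0)
            = real (Suc n) * (1 / real (Suc n) * (\<Sum>i<Suc n. Z i \<omega>) - expectation (Z 0))"
          by (simp add: field_simps del: of_nat_Suc sum.lessThan_Suc)
        finally show ?case
          by (simp add: abs_mult del: of_nat_Suc sum.lessThan_Suc)
      qed
      then show ?case by (subst eventually_sequentially_Suc[symmetric])
    qed
  qed
  then have "AE \<omega> in M. \<forall>m. \<forall>\<^sub>F n in sequentially.
      \<bar>1 / real n * (\<Sum>i<n. Z i \<omega>) - expectation (Z 0)\<bar> < 1 / real (Suc m)"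
    by (subst AE_all_countable) simp
  then show ?thesis
  proof eventually_elim
    case (elim \<omega>)
    show ?case
    proof (rule tendstoI)
      fix e :: real assume "e > 0"
      then obtain m where m: "1 / real (Suc m) < e"
        using nat_approx_posE by blast
      from elim have "\<forall>\<^sub>F n in sequentially.
        \<bar>1 / real n * (\<Sum>i<n. Z i \<omega>) - expectation (Z 0)\<bar> < 1 / real (Suc m)" ..
      then show "\<forall>\<^sub>F n in sequentially. dist (1 / real n * (\<Sum>i<n. Z i \<omega>)) (expectation (Z 0)) < e"
        by eventually_elim (use m in \<open>simp add: dist_real_def\<close>)
    qed
  qed
qed

section \<open>Independence of the pairs of observation pattern and data point\<close>

text \<open>
  Independence within each of the two sequences, together with independence of the sequences
  from each other, makes probabilities factor on intersections of finitely many rectangles.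
  The rectangles are stable under intersection and generate the product \<open>\<sigma>\<close>-algebras.
\<close>

lemma (in prob_space) indep_vars_Pair:
  assumes X: "indep_vars S X (UNIV :: 'i set)" and Y: "indep_vars T Y UNIV"
    and XY: "indep_var (\<Pi>\<^sub>M i\<in>UNIV. S i) (\<lambda>\<omega> i. X i \<omega>) (\<Pi>\<^sub>M i\<in>UNIV. T i) (\<lambda>\<omega> i. Y i \<omega>)"
  shows "indep_vars (\<lambda>i. S i \<Otimes>\<^sub>M T i) (\<lambda>i \<omega>. (X i \<omega>, Y i \<omega>)) UNIV"
proof -
  have rv [measurable]: "random_variable (S i) (X i)" "random_variable (T i) (Y i)" for i
    using X Y by (auto simp: indep_vars_def)
  define XE where "XE i A = X i -` A \<inter> space M" for i A
  define YE where "YE i B = Y i -` B \<inter> space M" for i B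
  define F where "F i = {XE i A \<inter> YE i B | A B. A \<in> sets (S i) \<and> B \<in> sets (T i)}" for i
  have prob_rect: "prob ((\<Inter>i\<in>J. XE i (A i)) \<inter> (\<Inter>i\<in>J. YE i (B i)))
      = (\<Prod>i\<in>J. prob (XE i (A i))) * (\<Prod>i\<in>J. prob (YE i (B i)))"
    if J: "finite J" "J \<noteq> {}" and A: "\<And>i. i \<in> J \<Longrightarrow> A i \<in> sets (S i)"
      and B: "\<And>i. i \<in> J \<Longrightarrow> B i \<in> sets (T i)" for J A B
  proof -
    let ?PA = "{f \<in> space (\<Pi>\<^sub>M i\<in>UNIV. S i). \<forall>i\<in>J. f i \<in> A i}"
    let ?PB = "{f \<in> space (\<Pi>\<^sub>M i\<in>UNIV. T i). \<forall>i\<in>J. f i \<in> B i}"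
    have "?PA \<in> sets (\<Pi>\<^sub>M i\<in>UNIV. S i)"
    proof (intro sets.sets_Collect_finite_All' J sets_Collect_single')
      fix i assume "i \<in> J"
      from sets.Int[OF sets.top A[OF this]]
      show "{f \<in> space (S i). f \<in> A i} \<in> sets (S i)"
        by (simp add: Int_def)
    qed simp
    moreover have "?PB \<in> sets (\<Pi>\<^sub>M i\<in>UNIV. T i)"
    proof (intro sets.sets_Collect_finite_All' J sets_Collect_single')
      fix i assume "i \<in> J"
      from sets.Int[OF sets.top B[OF this]]
      show "{f \<in> space (T i). f \<in> B i} \<in> sets (T i)"
        by (simp add: Int_def)
    qed simp
    ultimately
    have "prob ((\<lambda>\<omega>. (\<lambda>i. X i \<omega>, \<lambda>i. Y i \<omega>)) -` (?PA \<times> ?PB) \<inter> space M)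
      = prob ((\<lambda>\<omega> i. X i \<omega>) -` ?PA \<inter> space M) * prob ((\<lambda>\<omega> i. Y i \<omega>) -` ?PB \<inter> space M)"
      by (rule indep_varD[OF XY])
    also have "(\<lambda>\<omega>. (\<lambda>i. X i \<omega>, \<lambda>i. Y i \<omega>)) -` (?PA \<times> ?PB) \<inter> space M
        = (\<Inter>i\<in>J. XE i (A i)) \<inter> (\<Inter>i\<in>J. YE i (B i))"
      using J(2) measurable_space[OF rv(1)] measurable_space[OF rv(2)]
      by (auto simp: XE_def YE_def space_PiM)
    also have "(\<lambda>\<omega> i. X i \<omega>) -` ?PA \<inter> space M = (\<Inter>i\<in>J. XE i (A i))"
      using J(2) measurable_space[OF rv(1)] by (auto simp: XE_def space_PiM)
    also have "(\<lambda>\<omega> i. Y i \<omega>) -` ?PB \<inter> space M = (\<Inter>i\<in>J. YE i (B i))"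
      using J(2) measurable_space[OF rv(2)] by (auto simp: YE_def space_PiM)
    also have "prob (\<Inter>i\<in>J. XE i (A i)) = (\<Prod>i\<in>J. prob (XE i (A i)))"
      unfolding XE_def by (rule indep_varsD[OF X]) (use J A in auto)
    also have "prob (\<Inter>i\<in>J. YE i (B i)) = (\<Prod>i\<in>J. prob (YE i (B i)))"
      unfolding YE_def by (rule indep_varsD[OF Y]) (use J B in auto)
    finally show ?thesis .
  qed
  have "indep_sets F UNIV"
  proof (rule indep_setsI)
    show "F i \<subseteq> events" for i
      by (auto simp: F_def XE_def YE_def)
  next
    fix E J assume J: "J \<noteq> {}" "J \<subseteq> UNIV" "finite (J :: 'i set)" and "\<forall>i\<in>J. E i \<in> F i"
    then have "\<forall>i\<in>J. \<exists>A B. E i = XE i A \<inter> YE i B \<and> A \<in> sets (S i) \<and> B \<in> sets (T i)"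
      by (auto simp: F_def)
    then obtain A B where AB: "\<And>i. i \<in> J \<Longrightarrow> E i = XE i (A i) \<inter> YE i (B i)"
      "\<And>i. i \<in> J \<Longrightarrow> A i \<in> sets (S i)" "\<And>i. i \<in> J \<Longrightarrow> B i \<in> sets (T i)"
      by metis
    have single: "prob (E i) = prob (XE i (A i)) * prob (YE i (B i))" if "i \<in> J" for i
      using prob_rect[of "{i}" A B] AB that by simp
    have "(\<Inter>i\<in>J. E i) = (\<Inter>i\<in>J. XE i (A i)) \<inter> (\<Inter>i\<in>J. YE i (B i))"
      using AB(1) by auto
    then have "prob (\<Inter>i\<in>J. E i) = (\<Prod>i\<in>J. prob (XE i (A i))) * (\<Prod>i\<in>J. prob (YE i (B i)))"
      using prob_rect[OF J(3,1), of A B] AB by simp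
    also have "\<dots> = (\<Prod>i\<in>J. prob (E i))"
      by (simp add: single prod.distrib)
    finally show "prob (\<Inter>i\<in>J. E i) = (\<Prod>i\<in>J. prob (E i))" .
  qed
  moreover have "Int_stable (F i)" for i
  proof (rule Int_stableI)
    fix a b assume "a \<in> F i" "b \<in> F i"
    then obtain A B A' B' where "a = XE i A \<inter> YE i B" "b = XE i A' \<inter> YE i B'"
      and *: "A \<in> sets (S i)" "B \<in> sets (T i)" "A' \<in> sets (S i)" "B' \<in> sets (T i)"
      by (auto simp: F_def)
    then have "a \<inter> b = XE i (A \<inter> A') \<inter> YE i (B \<inter> B')"
      by (auto simp: XE_def YE_def)
    with * show "a \<inter> b \<in> F i"
      unfolding F_def by blast
  qed
  ultimately have indep: "indep_sets (\<lambda>i. sigma_sets (space M) (F i)) UNIV"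
    by (intro indep_sets_sigma)
  have "{(\<lambda>\<omega>. (X i \<omega>, Y i \<omega>)) -` E \<inter> space M | E. E \<in> sets (S i \<Otimes>\<^sub>M T i)}
      \<subseteq> sigma_sets (space M) (F i)" for i
  proof -
    let ?G = "{a \<times> b | a b. a \<in> sets (S i) \<and> b \<in> sets (T i)}"
    have "{(\<lambda>\<omega>. (X i \<omega>, Y i \<omega>)) -` E \<inter> space M | E. E \<in> sets (S i \<Otimes>\<^sub>M T i)}
        = sigma_sets (space M) {(\<lambda>\<omega>. (X i \<omega>, Y i \<omega>)) -` E \<inter> space M | E. E \<in> ?G}"
      unfolding sets_pair_measure
      by (rule sigma_sets_vimage_commute)
        (use measurable_space[OF rv(1)] measurable_space[OF rv(2)] in auto)
    also have "\<dots> \<subseteq> sigma_sets (space M) (F i)"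
    proof (rule sigma_sets_mono', safe)
      fix a b assume "a \<in> sets (S i)" "b \<in> sets (T i)"
      moreover have "(\<lambda>\<omega>. (X i \<omega>, Y i \<omega>)) -` (a \<times> b) \<inter> space M = XE i a \<inter> YE i b"
        by (auto simp: XE_def YE_def)
      ultimately show "(\<lambda>\<omega>. (X i \<omega>, Y i \<omega>)) -` (a \<times> b) \<inter> space M \<in> F i"
        unfolding F_def by blast
    qed
    finally show ?thesis .
  qed
  then show ?thesis
    unfolding indep_vars_def2 by (auto intro: indep_sets_mono_sets[OF indep])
qed

lemma (in prob_space) indep_var_component:
  assumes "indep_var (\<Pi>\<^sub>M i\<in>UNIV. S i) (\<lambda>\<omega> i. X i \<omega>) (\<Pi>\<^sub>M i\<in>UNIV. T i) (\<lambda>\<omega> i. Y i \<omega>)"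
  shows "indep_var (S i) (X i) (T i) (Y i)"
  using indep_var_compose[OF assms, of "\<lambda>f. f i" "S i" "\<lambda>f. f i" "T i"]
  by (simp add: o_def)

section \<open>The empirical and the expected loss\<close>

lemma borel_measurable_kpod_cost [measurable (raw)]:
  fixes r x :: "'a \<Rightarrow> real ^ 'p" and \<mu> :: "real ^ 'p ^ 'k"
  assumes [measurable]: "r \<in> borel_measurable N" "x \<in> borel_measurable N"
  shows "(\<lambda>\<omega>. kpod_cost (r \<omega>) (x \<omega>) \<mu>) \<in> borel_measurable N"
proof -
  have [measurable]: "(\<lambda>v :: real ^ 'p. v $ j) \<in> borel_measurable borel" for j
    by (intro borel_measurable_continuous_onI continuous_intros)
  show ?thesis
    unfolding kpod_cost_def by measurable
qed

lemma respects_domination_empirical: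
  fixes X R :: "nat \<Rightarrow> 'w \<Rightarrow> real ^ 'p"
  assumes n: "n \<ge> 1" and "\<And>i. obs_mask (R i \<omega>)" "\<And>i. norm (X i \<omega>) \<le> C"
  shows "respects_domination C (kpod_empirical_loss R X n \<omega> :: real ^ 'p ^ 'k \<Rightarrow> real)"
  unfolding respects_domination_def
proof (intro allI impI)
  fix \<delta> :: real and \<kappa> \<mu> :: "real ^ 'p ^ 'k"
  assume "\<delta> > 0" and dom: "almost_dominates C \<delta> \<kappa> \<mu>"
  have "(\<Sum>i<n. kpod_cost (R i \<omega>) (X i \<omega>) \<kappa>)
      \<le> (\<Sum>i<n. (1 + \<delta>) * kpod_cost (R i \<omega>) (X i \<omega>) \<mu> + (\<delta> + \<delta>\<^sup>2))"
    using dom assms(2,3) unfolding almost_dominates_def by (intro sum_mono) blast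
  also have "\<dots> = (1 + \<delta>) * (\<Sum>i<n. kpod_cost (R i \<omega>) (X i \<omega>) \<mu>) + real n * (\<delta> + \<delta>\<^sup>2)"
    by (simp add: sum.distrib sum_distrib_left)
  finally show "kpod_empirical_loss R X n \<omega> \<kappa>
      \<le> (1 + \<delta>) * kpod_empirical_loss R X n \<omega> \<mu> + (\<delta> + \<delta>\<^sup>2)"
    using n unfolding kpod_empirical_loss_def by (simp add: field_simps)
qed

lemma (in prob_space) integrable_kpod_cost:
  assumes [measurable]: "random_variable borel r" "random_variable borel x"
    and r: "AE \<omega> in M. obs_mask (r \<omega>)" and x: "AE \<omega> in M. norm (x \<omega>) \<le> C"
  shows "integrable M (\<lambda>\<omega>. kpod_cost (r \<omega>) (x \<omega>) \<mu>)"
proof (rule integrable_const_bound)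
  show "AE \<omega> in M. norm (kpod_cost (r \<omega>) (x \<omega>) \<mu>) \<le> (C + norm \<mu>)\<^sup>2"
    using r x by eventually_elim (simp add: kpod_cost_le kpod_cost_nonneg)
qed measurable

lemma (in prob_space) respects_domination_kpod_loss:
  fixes r x :: "'a \<Rightarrow> real ^ 'p"
  assumes rv: "random_variable borel r" "random_variable borel x"
    and r: "AE \<omega> in M. obs_mask (r \<omega>)" and x: "AE \<omega> in M. norm (x \<omega>) \<le> C"
  shows "respects_domination C (kpod_loss M r x :: real ^ 'p ^ 'k \<Rightarrow> real)"
  unfolding respects_domination_def
proof (intro allI impI)
  note int [simp] = integrable_kpod_cost[OF rv r x]
  fix \<delta> :: real and \<kappa> \<mu> :: "real ^ 'p ^ 'k"
  assume "\<delta> > 0" and dom: "almost_dominates C \<delta> \<kappa> \<mu>"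
  have "kpod_loss M r x \<kappa> \<le> (\<integral>\<omega>. (1 + \<delta>) * kpod_cost (r \<omega>) (x \<omega>) \<mu> + (\<delta> + \<delta>\<^sup>2) \<partial>M)"
    unfolding kpod_loss_def
  proof (rule integral_mono_AE)
    show "AE \<omega> in M. kpod_cost (r \<omega>) (x \<omega>) \<kappa> \<le> (1 + \<delta>) * kpod_cost (r \<omega>) (x \<omega>) \<mu> + (\<delta> + \<delta>\<^sup>2)"
      using r x by eventually_elim (use dom in \<open>simp add: almost_dominates_def\<close>)
  qed auto
  also have "\<dots> = (1 + \<delta>) * kpod_loss M r x \<mu> + (\<delta> + \<delta>\<^sup>2)"
    by (simp add: kpod_loss_def prob_space)
  finally show "kpod_loss M r x \<kappa> \<le> (1 + \<delta>) * kpod_loss M r x \<mu> + (\<delta> + \<delta>\<^sup>2)" .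
qed

lemma bdd_below_kpod_loss:
  assumes "AE \<omega> in M. obs_mask (r \<omega>)"
  shows "bdd_below (range (kpod_loss M r x))"
proof (rule bdd_belowI2)
  show "0 \<le> kpod_loss M r x \<mu>" for \<mu>
    unfolding kpod_loss_def
  proof (rule integral_nonneg_AE)
    show "AE \<omega> in M. 0 \<le> kpod_cost (r \<omega>) (x \<omega>) \<mu>"
      using assms by eventually_elim (rule kpod_cost_nonneg)
  qed
qed

text \<open>
  The strong law applies to the costs of the pairs \<open>(R i, X i)\<close>. These are identically
  distributed because each joint law is the product of \<open>Q\<close> and \<open>P\<close>.
\<close>

lemma (in prob_space) kpod_empirical_loss_tendsto:
  fixes X R :: "nat \<Rightarrow> 'a \<Rightarrow> real ^ 'p" and \<mu> :: "real ^ 'p ^ 'k"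
  assumes X: "indep_vars (\<lambda>_. borel) X UNIV" and P: "\<And>i. distr M borel (X i) = P"
    and R: "indep_vars (\<lambda>_. borel) R UNIV" and Q: "\<And>i. distr M borel (R i) = Q"
    and RX: "indep_var (\<Pi>\<^sub>M i\<in>UNIV. borel) (\<lambda>\<omega> i. R i \<omega>) (\<Pi>\<^sub>M i\<in>UNIV. borel) (\<lambda>\<omega> i. X i \<omega>)"
    and obs: "AE \<omega> in M. obs_mask (R 0 \<omega>)" and bounded: "AE \<omega> in M. norm (X 0 \<omega>) \<le> C"
  shows "AE \<omega> in M. (\<lambda>n. kpod_empirical_loss R X n \<omega> \<mu>) \<longlonglongrightarrow> kpod_loss M (R 0) (X 0) \<mu>"
proof -
  define g :: "(real ^ 'p) \<times> (real ^ 'p) \<Rightarrow> real" where "g z = kpod_cost (fst z) (snd z) \<mu>" for z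
  have g [measurable]: "g \<in> borel_measurable (borel \<Otimes>\<^sub>M borel)"
    unfolding g_def by measurable
  have [measurable]: "random_variable borel (X i)" "random_variable borel (R i)" for i
    using X R by (auto simp: indep_vars_def)
  have "distr M (borel \<Otimes>\<^sub>M borel) (\<lambda>\<omega>. (R i \<omega>, X i \<omega>)) = Q \<Otimes>\<^sub>M P" for i
    using indep_var_component[OF RX, of i] by (simp add: indep_var_distribution_eq P Q)
  then have distr: "distr M borel (\<lambda>\<omega>. g (R i \<omega>, X i \<omega>)) = distr (Q \<Otimes>\<^sub>M P) borel g" for i
    using distr_distr[OF g, of "\<lambda>\<omega>. (R i \<omega>, X i \<omega>)" M] by (simp add: o_def)
  have "AE \<omega> in M. (\<lambda>n. 1 / real n * (\<Sum>i<n. g (R i \<omega>, X i \<omega>)))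
      \<longlonglongrightarrow> expectation (\<lambda>\<omega>. g (R 0 \<omega>, X 0 \<omega>))"
  proof (rule strong_law_bounded)
    show "indep_vars (\<lambda>_. borel) (\<lambda>i \<omega>. g (R i \<omega>, X i \<omega>)) UNIV"
      by (rule indep_vars_compose2[OF indep_vars_Pair[OF R X RX]]) (rule g)
    show "distr M borel (\<lambda>\<omega>. g (R i \<omega>, X i \<omega>)) = distr M borel (\<lambda>\<omega>. g (R 0 \<omega>, X 0 \<omega>))" for i
      by (simp only: distr)
    show "AE \<omega> in M. \<bar>g (R 0 \<omega>, X 0 \<omega>)\<bar> \<le> (C + norm \<mu>)\<^sup>2"
      using obs bounded by eventually_elim (simp add: g_def kpod_cost_le kpod_cost_nonneg)
  qed
  then show ?thesis
    by (simp add: g_def kpod_empirical_loss_def kpod_loss_def)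
qed

section \<open>Consistency of k-POD clustering\<close>

theorem theorem2p2:
  fixes N :: "'w measure"
    and P Q :: "(real ^ 'p) measure"
    and X R :: "nat \<Rightarrow> 'w \<Rightarrow> real ^ 'p"
    and Mhat :: "nat \<Rightarrow> 'w \<Rightarrow> real ^ 'p ^ 'k"
    and C :: real
  assumes "prob_space N"
    and "prob_space.indep_vars N (\<lambda>_. borel) X UNIV"
    and "\<And>i. distr N borel (X i) = P"
    and "prob_space.indep_vars N (\<lambda>_. borel) R UNIV"
    and "\<And>i. distr N borel (R i) = Q"
    and "\<And>i \<omega> j. \<omega> \<in> space N \<Longrightarrow> R i \<omega> $ j \<in> {0, 1}"
    and "prob_space.indep_var N
           (\<Pi>\<^sub>M i\<in>UNIV. borel) (\<lambda>\<omega> i. R i \<omega>) (\<Pi>\<^sub>M i\<in>UNIV. borel) (\<lambda>\<omega> i. X i \<omega>)"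
    and "measure N {\<omega> \<in> space N. \<forall>j. R 0 \<omega> $ j = 1} > 0"
    and "C > 0" and "AE \<omega> in N. norm (X 0 \<omega>) < C"
    and "\<And>n \<omega>. n \<ge> 1 \<Longrightarrow> \<omega> \<in> space N \<Longrightarrow>
           Mhat n \<omega> \<in> argmin_set (kpod_empirical_loss R X n \<omega>)"
  shows "argmin_set (kpod_loss N (R 0) (X 0) :: real ^ 'p ^ 'k \<Rightarrow> real) \<noteq> {} \<and>
    (\<forall>\<mu> :: real ^ 'p ^ 'k. \<exists>\<mu>' \<in> argmin_set (kpod_loss N (R 0) (X 0)).
        infdist \<mu> (argmin_set (kpod_loss N (R 0) (X 0))) = norm (\<mu> - \<mu>')) \<and>
    (AE \<omega> in N.
      (\<lambda>n. kpod_loss N (R 0) (X 0) (Mhat n \<omega>))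
        \<longlonglongrightarrow> (INF \<mu> :: real ^ 'p ^ 'k. kpod_loss N (R 0) (X 0) \<mu>) \<and>
      (\<lambda>n. infdist (Mhat n \<omega>) (argmin_set (kpod_loss N (R 0) (X 0)))) \<longlonglongrightarrow> 0)"
proof -
  interpret prob_space N by fact
  let ?L = "kpod_loss N (R 0) (X 0) :: real ^ 'p ^ 'k \<Rightarrow> real"
  have C: "C \<ge> 0" using \<open>C > 0\<close> by simp
  have [measurable]: "random_variable borel (X i)" "random_variable borel (R i)" for i
    using assms(2,4) by (auto simp: indep_vars_def)
  have obs: "obs_mask (R i \<omega>)" if "\<omega> \<in> space N" for i \<omega>
    using assms(6)[OF that] by (simp add: obs_mask_def)
  then have AE_obs: "AE \<omega> in N. obs_mask (R i \<omega>)" for i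
    by simp
  have "AE \<omega> in N. norm (X i \<omega>) \<le> C" for i
  proof -
    have "AE v in P. norm v \<le> C"
      unfolding assms(3)[of 0, symmetric] using assms(10) by (subst AE_distr_iff) auto
    then show ?thesis
      unfolding assms(3)[of i, symmetric] by (subst (asm) AE_distr_iff) auto
  qed
  then have bounded: "AE \<omega> in N. \<forall>i. norm (X i \<omega>) \<le> C"
    by (simp add: AE_all_countable)
  then have bounded0: "AE \<omega> in N. norm (X 0 \<omega>) \<le> C"
    by eventually_elim simp
  have L: "respects_domination C ?L"
    by (intro respects_domination_kpod_loss AE_obs bounded0) measurable
  have ne: "argmin_set ?L \<noteq> {}"
    by (intro argmin_set_nonempty[OF C L] bdd_below_kpod_loss AE_obs)
  have attained: "\<exists>\<mu>'\<in>argmin_set ?L. infdist \<mu> (argmin_set ?L) = norm (\<mu> - \<mu>')" for \<mu>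
    using infdist_attains_inf[OF closed_argmin_set[OF L] ne, of \<mu>] by (auto simp: dist_norm)
  obtain D :: "(real ^ 'p ^ 'k) set" where D: "countable D"
    "\<And>U. open U \<Longrightarrow> U \<noteq> {} \<Longrightarrow> \<exists>\<nu>\<in>D. \<nu> \<in> U"
    using countable_dense_exists by blast
  have "AE \<omega> in N. \<forall>\<nu>\<in>D. (\<lambda>n. kpod_empirical_loss R X n \<omega> \<nu>) \<longlonglongrightarrow> ?L \<nu>"
    by (intro AE_ball_countable[THEN iffD2] D ballI
        kpod_empirical_loss_tendsto[OF assms(2,3,4,5,7) AE_obs bounded0])
  then have "AE \<omega> in N. (\<lambda>n. ?L (Mhat n \<omega>)) \<longlonglongrightarrow> (INF \<mu>. ?L \<mu>) \<and>
      (\<lambda>n. infdist (Mhat n \<omega>) (argmin_set ?L)) \<longlonglongrightarrow> 0"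
    using bounded AE_space
  proof eventually_elim
    case (elim \<omega>)
    have f: "\<forall>\<^sub>F n in sequentially. respects_domination C
        (kpod_empirical_loss R X n \<omega> :: real ^ 'p ^ 'k \<Rightarrow> real)"
      using eventually_ge_at_top[of 1]
      by eventually_elim (use elim obs in \<open>auto intro: respects_domination_empirical\<close>)
    have conv: "(\<lambda>n. kpod_empirical_loss R X n \<omega> \<mu>) \<longlonglongrightarrow> ?L \<mu>" for \<mu>
      by (rule tendsto_of_tendsto_on_dense[OF f L D(2)]) (use elim(1) in auto)
    have "\<forall>\<^sub>F n in sequentially. Mhat n \<omega> \<in> argmin_set (kpod_empirical_loss R X n \<omega>)"
      using eventually_ge_at_top[of 1] by eventually_elim (use assms(11) elim(3) in auto)
    from infdist_argmin_set_tendsto_0[OF C f conv this]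
    have "(\<lambda>n. infdist (Mhat n \<omega>) (argmin_set ?L)) \<longlonglongrightarrow> 0" .
    with tendsto_INF_of_infdist_argmin_set[OF L ne this] show ?case by blast
  qed
  with ne attained show ?thesis by blast
qed

end
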